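(* Let $k,n\in\mathbb{N}$. Then $$\max\{\mathrm{des}(x) : x\in[k]^n\}=\max\{\mathrm{cycdes}(x) : x\in[k]^n\}=\left\lfloor \frac{n(k-1)}{k}\right\rfloor.$$
   Context: $\mathbb{N}=\{1,2,\ldots\}$ and $[k]=\{1,\ldots,k\}$. For a word $x=x_1\cdots x_n\in[k]^n$, $\mathrm{des}(x)$ is the number of descents of $x$, i.e. of indices $1\leq i\leq n-1$ with $x_i>x_{i+1}$. When the word is regarded as cyclic, $i=n$ is also a (cyclic) descent if $x_n>x_1$; $\mathrm{cycdes}(x)$ is the number of descents and cyclic descents, i.e. $\mathrm{cycdes}(x)=\mathrm{des}(x)+1$ if $x_n>x_1$ and $\mathrm{cycdes}(x)=\mathrm{des}(x)$ otherwise. *)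

theory Defs
  imports Complex_Main
begin

definition words :: "nat \<Rightarrow> nat \<Rightarrow> nat list set" where
  "words k n = {x. length x = n \<and> set x \<subseteq> {1..k}}"

(* List positions start at 0, so the letter x_i is x ! (i - 1). *)

definition des :: "nat list \<Rightarrow> nat" where
  "des x = card {i. 1 \<le> i \<and> i < length x \<and> x ! (i - 1) > x ! i}"

(* The guard only excludes the empty word, for which hd and last are unspecified. *)

definition cycdes :: "nat list \<Rightarrow> nat" where
  "cycdes x = (if x \<noteq> [] \<and> last x > hd x then des x + 1 else des x)"

end

theory Submission
  imports Defs
begin

text \<open>
  Going once around the cycle, the differences of consecutive letters add up to \<open>0\<close>. A descent
  contributes at most \<open>-1\<close> and every other step at most \<open>k - 1\<close>, so \<open>d\<close> cyclic descents force
  \<open>0 \<le> n(k - 1) - kd\<close>; this is the upper bound \<open>cycdes_upper_bound\<close>. It is already attained by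
  ordinary descents: the truncation to \<open>n\<close> letters of the periodic word \<open>k, k - 1, \<dots>, 1, k, \<dots>\<close>
  fails to descend only into the positions divisible by \<open>k\<close>, counted from \<open>0\<close>
  (\<open>des_sawtooth_lower_bound\<close>). As \<open>des \<le> cycdes\<close>, both maxima equal the common bound.
\<close>

text \<open>
  A descent falls short of the largest possible step \<open>k - 1\<close> by at least \<open>k\<close>. Summed over the
  word the steps telescope, so the number of descents is controlled by the two end letters.
\<close>

lemma descents_bound_by_ends:
  assumes "x \<in> words k n" and "n \<ge> 1"
  shows "int k * int (des x) \<le> (int n - 1) * (int k - 1) - (int (last x) - int (hd x))"
proof -
  have len: "length x = n" and letters: "\<And>i. i < n \<Longrightarrow> 1 \<le> x ! i \<and> x ! i \<le> k"
    using assms(1) nth_mem unfolding words_def by fastforce+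
  let ?I = "{Suc 0..n - 1}"
  let ?D = "{i \<in> ?I. x ! (i - 1) > x ! i}"
  have des: "des x = card ?D"
    unfolding des_def by (rule arg_cong[where f = card]) (auto simp: len)
  have ends: "last x = x ! (n - 1)" "hd x = x ! 0"
    using len assms(2) last_conv_nth[of x] hd_conv_nth[of x] by (cases "x = []"; simp)+
  have "(\<Sum>i\<in>?I. int (x ! i) - int (x ! (i - 1)))
      \<le> (\<Sum>i\<in>?I. (int k - 1) - int k * (if x ! (i - 1) > x ! i then 1 else 0))"
  proof (rule sum_mono)
    fix i assume "i \<in> ?I"
    then have "i < n" "i - 1 < n" by auto
    then show "int (x ! i) - int (x ! (i - 1))
        \<le> (int k - 1) - int k * (if x ! (i - 1) > x ! i then 1 else 0)"
      using letters[of i] letters[of "i - 1"] by auto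
  qed
  also have "\<dots> = (int n - 1) * (int k - 1) - int k * int (card ?D)"
    using assms(2) by (simp add: sum_subtractf flip: sum_distrib_left sum.inter_filter)
  finally show ?thesis
    using sum_telescope''[of 0 "n - 1" "\<lambda>i. int (x ! i)"] by (simp add: des ends)
qed

text \<open>
  The step from the last letter back to the first obeys the same estimate as the inner steps and
  cancels the contribution of the two ends.
\<close>

lemma cycdes_upper_bound:
  assumes "x \<in> words k n" and "n \<ge> 1"
  shows "cycdes x \<le> n * (k - 1) div k"
proof -
  have "x \<noteq> []" and "set x \<subseteq> {1..k}"
    using assms by (auto simp: words_def)
  then have hd: "1 \<le> hd x" "hd x \<le> k" and last: "1 \<le> last x"
    using hd_in_set[of x] last_in_set[of x] by fastforce+
  have k: "k \<ge> 1" using hd by simp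
  have "int (hd x) - int (last x) \<le> (int k - 1) - int k * (int (cycdes x) - int (des x))"
    using \<open>x \<noteq> []\<close> hd last by (auto simp: cycdes_def)
  then have "int k * int (cycdes x) \<le> int n * (int k - 1)"
    using descents_bound_by_ends[OF assms] by (simp add: algebra_simps)
  then have "int (cycdes x * k) \<le> int (n * (k - 1))"
    using k by (simp add: of_nat_diff mult.commute)
  then show ?thesis
    using k by (simp only: of_nat_le_iff) (simp add: less_eq_div_iff_mult_less_eq)
qed

definition sawtooth :: "nat \<Rightarrow> nat \<Rightarrow> nat list" where
  "sawtooth k n = map (\<lambda>i. k - i mod k) [0..<n]"

lemma sawtooth_in_words: "k \<ge> 1 \<Longrightarrow> sawtooth k n \<in> words k n"
  by (auto simp: sawtooth_def words_def Suc_le_eq)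

lemma sawtooth_descent:
  assumes "1 \<le> i" "i < n" "\<not> k dvd i" "k \<ge> 1"
  shows "sawtooth k n ! (i - 1) > sawtooth k n ! i"
proof -
  obtain j where i: "i = Suc j" using assms(1) by (cases i) auto
  have "i mod k = Suc (j mod k)"
    using assms(3) by (auto simp: i mod_Suc dvd_eq_mod_eq_0)
  moreover have "i mod k < k" using assms(4) by simp
  ultimately show ?thesis using assms(2) by (simp add: sawtooth_def i)
qed

text \<open>
  Among the \<open>n - 1\<close> inner positions at most \<open>(n - 1) div k\<close> are multiples of \<open>k\<close>; all others are
  descents, and \<open>n - 1 - (n - 1) div k\<close> is another form of the rounded-down quotient.
\<close>

lemma des_sawtooth_lower_bound:
  assumes "k \<ge> 1" and "n \<ge> 1"
  shows "n * (k - 1) div k \<le> des (sawtooth k n)"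
proof -
  define q where "q = (n - 1) div k"
  let ?M = "{i \<in> {1..<n}. k dvd i}"
  have "?M \<subseteq> (*) k ` {1..q}"
  proof
    fix i assume "i \<in> ?M"
    then obtain j where j: "i = k * j" and i: "1 \<le> i" "i \<le> n - 1" by auto
    then have "1 \<le> j" "j \<le> q"
      using assms(1) by (auto simp: q_def less_eq_div_iff_mult_less_eq mult.commute Suc_le_eq)
    then show "i \<in> (*) k ` {1..q}" using j by auto
  qed
  then have "card ?M \<le> q"
    using surj_card_le[of "{1..q}" ?M "(*) k"] by simp
  then have "n - 1 - q \<le> card ({1..<n} - ?M)"
    using diff_card_le_card_Diff[of ?M "{1..<n}"] by simp
  also have "\<dots> \<le> des (sawtooth k n)"
    unfolding des_def
    by (rule card_mono) (use sawtooth_descent assms(1) in \<open>auto simp: sawtooth_def\<close>)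
  finally have des: "n - 1 - q \<le> des (sawtooth k n)" .
  have "q * k \<le> n - 1" unfolding q_def by simp
  then have qk: "q * k < n" using assms(2) by linarith
  moreover have "q \<le> q * k" using assms(1) by simp
  ultimately have qn: "q < n" by linarith
  have "int (n * (k - 1)) < int ((n - q) * k)"
    using qk qn assms(1) by (simp add: of_nat_diff algebra_simps flip: of_nat_mult)
  then have "n * (k - 1) < (n - q) * k" by (simp only: of_nat_less_iff)
  then have "n * (k - 1) div k < n - q"
    using assms(1) by (simp add: div_less_iff_less_mult)
  then show ?thesis using des by linarith
qed

lemma des_le_cycdes: "des x \<le> cycdes x"
  by (simp add: cycdes_def)

theorem lemma8:
  fixes k n :: nat
  assumes "k \<ge> 1" and "n \<ge> 1"
  shows "Max {des x | x. x \<in> words k n} = Max {cycdes x | x. x \<in> words k n}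
       \<and> int (Max {cycdes x | x. x \<in> words k n}) = \<lfloor>real n * (real k - 1) / real k\<rfloor>"
proof -
  define m where "m = n * (k - 1) div k"
  note upper = cycdes_upper_bound[OF _ assms(2), of _ k, folded m_def]
  note word = sawtooth_in_words[OF assms(1), of n]
  note lower = des_sawtooth_lower_bound[OF assms, folded m_def]
  \<comment> \<open>The chain \<open>m \<le> des \<le> cycdes \<le> m\<close> collapses at the sawtooth word.\<close>
  have attained: "des (sawtooth k n) = m" "cycdes (sawtooth k n) = m"
    using upper[OF word] lower des_le_cycdes[of "sawtooth k n"] by linarith+
  have Max_eq: "Max {f x | x. x \<in> words k n} = m"
    if bound: "\<And>x. x \<in> words k n \<Longrightarrow> f x \<le> m" and "f (sawtooth k n) = m" for f
  proof (rule Max_eqI)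
    show "finite {f x | x. x \<in> words k n}"
      by (rule finite_subset[of _ "{..m}"]) (use bound in auto)
  qed (use that word in auto)
  have "Max {des x | x. x \<in> words k n} = m"
    by (rule Max_eq[of des, OF order_trans[OF des_le_cycdes upper] attained(1)])
  moreover have "Max {cycdes x | x. x \<in> words k n} = m"
    by (rule Max_eq[of cycdes, OF upper attained(2)])
  moreover have "int m = \<lfloor>real n * (real k - 1) / real k\<rfloor>"
    using assms(1) floor_divide_of_nat_eq[of "n * (k - 1)" k, where ?'a = real]
    by (simp add: m_def of_nat_diff)
  ultimately show ?thesis by simp
qed

end
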